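(* Let $\lambda$ be a nonzero real number. For every integer $n\ge 1$ and every real $x$ (equivalently, as an identity of polynomials in $x$ over $\mathbb{R}$), $$\frac{M_{n+1,\lambda}}{n+1}=(x+1)_{n,\lambda}+\sum_{j=1}^{n}\sum_{k=1}^{j}\binom{n}{j}(x+1)_{n-j,\lambda}(-1)^{k}k!\,B_{j,k}\big(\beta_{1,\lambda}(x),\beta_{2,\lambda}(x),\dots,\beta_{j-k+1,\lambda}(x)\big),$$ where $M_{n,\lambda}$ are the dimorphic Mersenne numbers, $(x)_{n,\lambda}$ is the degenerate falling factorial, $\beta_{n,\lambda}(x)$ are the degenerate Bernoulli polynomials, and $B_{j,k}$ are the incomplete Bell polynomials.
   Context: Let $\lambda\in\mathbb{R}$ be nonzero. The degenerate falling factorial is $(x)_{0,\lambda}=1$ and $(x)_{n,\lambda}=x(x-\lambda)(x-2\lambda)\cdots(x-(n-1)\lambda)$ for $n\ge 1$. The degenerate exponentials are the formal power series in $t$ $$e_{\lambda}^{x}(t)=(1+\lambda t)^{x/\lambda}=\sum_{n=0}^{\infty}(x)_{n,\lambda}\frac{t^{n}}{n!},\qquad e_{\lambda}(t)=e_{\lambda}^{1}(t).$$ The degenerate Bernoulli polynomials $\beta_{n,\lambda}(x)$, $n\ge 0$, are defined by $$\frac{t}{e_{\lambda}(t)-1}e_{\lambda}^{x}(t)=\sum_{n=0}^{\infty}\beta_{n,\lambda}(x)\frac{t^{n}}{n!}.$$ The dimorphic Mersenne numbers are $M_{n,\lambda}=(2)_{n,\lambda}-(1)_{n,\lambda}$ for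 $n\ge 0$. The incomplete Bell polynomials $B_{n,k}(x_{1},\dots,x_{n-k+1})$ are defined, for $k\ge 0$, by $$\frac{1}{k!}\bigg(\sum_{i=1}^{\infty}x_{i}\frac{t^{i}}{i!}\bigg)^{k}=\sum_{n=k}^{\infty}B_{n,k}(x_{1},\dots,x_{n-k+1})\frac{t^{n}}{n!};$$ explicitly, $$B_{n,k}(x_{1},\dots,x_{n-k+1})=\sum\frac{n!}{l_{1}!l_{2}!\cdots l_{n-k+1}!}\Big(\frac{x_{1}}{1!}\Big)^{l_{1}}\Big(\frac{x_{2}}{2!}\Big)^{l_{2}}\cdots\Big(\frac{x_{n-k+1}}{(n-k+1)!}\Big)^{l_{n-k+1}},$$ the sum being over all nonnegative integers $l_{1},\dots,l_{n-k+1}$ with $l_{1}+\cdots+l_{n-k+1}=k$ and $l_{1}+2l_{2}+\cdots+(n-k+1)l_{n-k+1}=n$. *)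

theory Defs
  imports Complex_Main "HOL-Computational_Algebra.Formal_Power_Series"
begin

definition degen_ffact :: "real \<Rightarrow> real \<Rightarrow> nat \<Rightarrow> real" where
  "degen_ffact lam x n = (\<Prod>i<n. x - real i * lam)"

definition degen_exp :: "real \<Rightarrow> real \<Rightarrow> real fps" where
  "degen_exp lam x = Abs_fps (\<lambda>n. degen_ffact lam x n / fact n)"

(* The quotient is taken in the ring of formal power series. As the denominator has
   subdegree 1, it is the exact quotient; see degen_bernoulli_gf. *)
definition degen_bernoulli :: "real \<Rightarrow> nat \<Rightarrow> real \<Rightarrow> real" where
  "degen_bernoulli lam n x =
     fact n * fps_nth (fps_X / (degen_exp lam 1 - 1) * degen_exp lam x) n"

definition dimorphic_mersenne :: "real \<Rightarrow> nat \<Rightarrow> real" where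
  "dimorphic_mersenne lam n = degen_ffact lam 2 n - degen_ffact lam 1 n"

(* The arguments of the incomplete Bell polynomial are passed as a sequence, of which
   x 0 is ignored; see incomplete_bell_cong for the arguments that matter. *)
definition incomplete_bell :: "nat \<Rightarrow> nat \<Rightarrow> (nat \<Rightarrow> real) \<Rightarrow> real" where
  "incomplete_bell n k x =
     fact n * fps_nth (fps_const (1 / fact k) *
       Abs_fps (\<lambda>i. if i = 0 then 0 else x i / fact i) ^ k) n"

lemma degen_exp_eq_binomial:
  assumes "lam \<noteq> 0"
  shows "degen_exp lam x = fps_binomial (x / lam) oo (fps_const lam * fps_X)"
proof (rule fps_ext)
  fix n
  have "lam ^ n * (\<Prod>i<n. x / lam - real i) = (\<Prod>i<n. x - real i * lam)"
    using assms by (induction n) (auto simp: field_simps)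
  then show "fps_nth (degen_exp lam x) n =
      fps_nth (fps_binomial (x / lam) oo (fps_const lam * fps_X)) n"
    by (simp add: degen_exp_def degen_ffact_def fps_compose_linear gbinomial_prod_rev
        atLeast0LessThan)
qed

lemma degen_bernoulli_gf:
  "Abs_fps (\<lambda>n. degen_bernoulli lam n x / fact n) * (degen_exp lam 1 - 1) =
     fps_X * degen_exp lam x"
proof -
  let ?D = "degen_exp lam 1 - 1"
  have c: "fps_nth ?D 0 = 0" "fps_nth ?D 1 = 1"
    by (simp_all add: degen_exp_def degen_ffact_def)
  then have nz: "?D \<noteq> 0" by (metis fps_zero_nth zero_neq_one)
  have "subdegree ?D = 1"
    using c by (intro subdegreeI) (auto simp: less_Suc_eq)
  then have "?D dvd fps_X"
    using nz by (simp add: fps_dvd_iff)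
  then have "fps_X / ?D * ?D = fps_X" by simp
  moreover have "Abs_fps (\<lambda>n. degen_bernoulli lam n x / fact n) = fps_X / ?D * degen_exp lam x"
    by (rule fps_ext) (simp add: degen_bernoulli_def)
  ultimately show ?thesis by (metis mult.assoc mult.commute)
qed

lemma incomplete_bell_cong:
  assumes "\<And>i. 1 \<le> i \<Longrightarrow> i \<le> n - k + 1 \<Longrightarrow> x i = y i"
  shows "incomplete_bell n k x = incomplete_bell n k y"
proof (cases k)
  case 0
  then show ?thesis by (simp add: incomplete_bell_def)
next
  case (Suc m)
  let ?f = "\<lambda>x. Abs_fps (\<lambda>i. if i = 0 then 0 else x i / fact i :: real)"
  have "(\<Prod>j\<in>{0..m}. fps_nth (?f x) (v ! j)) = (\<Prod>j\<in>{0..m}. fps_nth (?f y) (v ! j))"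
    if v: "v \<in> natpermute n (m + 1)" for v
  proof (cases "\<exists>j\<in>{0..m}. v ! j = 0")
    case True
    then obtain j where "j \<in> {0..m}" "v ! j = 0" by blast
    then have "(\<Prod>j\<in>{0..m}. fps_nth (?f z) (v ! j)) = 0" for z
      by (intro prod_zero bexI[of _ j]) auto
    then show ?thesis by metis
  next
    case False
    have s: "(\<Sum>i\<in>{0..m}. v ! i) = n"
      using v by (auto simp: natpermute_def sum_list_sum_nth atLeastLessThanSuc_atLeastAtMost)
    have "x (v ! j) = y (v ! j)" if j: "j \<in> {0..m}" for j
    proof (rule assms)
      show "1 \<le> v ! j" using False j by (auto simp: Suc_le_eq)
      have "n = v ! j + (\<Sum>i\<in>{0..m} - {j}. v ! i)"
        using j s by (metis finite_atLeastAtMost sum.remove)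
      moreover have "(\<Sum>i\<in>{0..m} - {j}. v ! i) \<ge> (\<Sum>i\<in>{0..m} - {j}. 1)"
        using False by (intro sum_mono) (auto simp: Suc_le_eq)
      moreover have "(\<Sum>i\<in>{0..m} - {j}. 1) = m" using j by simp
      ultimately show "v ! j \<le> n - k + 1" using Suc by linarith
    qed
    then show ?thesis by (intro prod.cong) auto
  qed
  then show ?thesis
    unfolding incomplete_bell_def Suc fps_mult_left_const_nth fps_power_nth_Suc
    by (simp cong: sum.cong)
qed

end

theory Submission
  imports Defs
begin

text \<open>
  Let \<open>B\<close> be the exponential generating function of the degenerate Bernoulli polynomials at \<open>x\<close>.
  Its constant term is \<open>1\<close>, so the geometric series in \<open>1 - B\<close> gives the coefficients of \<open>1 / B\<close>
  as alternating sums of incomplete Bell polynomials, and the right-hand side of the theorem is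
  \<open>n!\<close> times the \<open>n\<close>-th coefficient of \<open>e\<^sub>\<lambda>\<^sup>x\<^sup>+\<^sup>1(t) / B(t)\<close>. As \<open>B(t) = t e\<^sub>\<lambda>\<^sup>x(t) / (e\<^sub>\<lambda>(t) - 1)\<close>,
  this quotient equals \<open>e\<^sub>\<lambda>(t) (e\<^sub>\<lambda>(t) - 1) / t = (e\<^sub>\<lambda>\<^sup>2(t) - e\<^sub>\<lambda>(t)) / t\<close>.
\<close>

lemma degen_exp_nth [simp]: "fps_nth (degen_exp lam x) n = degen_ffact lam x n / fact n"
  by (simp add: degen_exp_def)

lemma degen_ffact_0 [simp]: "degen_ffact lam x 0 = 1"
  by (simp add: degen_ffact_def)

lemma degen_ffact_1 [simp]: "degen_ffact lam x (Suc 0) = x"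
  by (simp add: degen_ffact_def)

text \<open>The exponent law of the binomial series survives the substitution of
  \<open>lam * t\<close> for \<open>t\<close>, since composition respects products.\<close>

lemma degen_exp_add:
  assumes "lam \<noteq> 0"
  shows "degen_exp lam (x + y) = degen_exp lam x * degen_exp lam y"
  using assms
  by (simp add: degen_exp_eq_binomial add_divide_distrib fps_binomial_add_mult
      fps_compose_mult_distrib)

text \<open>Compare coefficients of \<open>t\<close> in the defining identity:
  \<open>degen_exp lam 1 - 1\<close> starts with \<open>t\<close>.\<close>

lemma degen_bernoulli_0: "degen_bernoulli lam 0 x = 1"
proof -
  have "fps_nth (Abs_fps (\<lambda>n. degen_bernoulli lam n x / fact n) * (degen_exp lam 1 - 1)) 1 =
      fps_nth (fps_X * degen_exp lam x) 1"
    by (simp only: degen_bernoulli_gf)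
  then show ?thesis
    by (simp add: fps_mult_nth)
qed

text \<open>Substitute \<open>F\<close> into the geometric series of
  \<open>1 / (1 + t)\<close>.\<close>

lemma fps_inverse_one_plus_nth:
  fixes F :: "'a :: field fps"
  assumes "fps_nth F 0 = 0"
  shows "fps_nth (inverse (1 + F)) n = (\<Sum>k = 0..n. (-1) ^ k * fps_nth (F ^ k) n)"
proof -
  have "inverse (1 + F) = inverse (1 + fps_X) oo F"
    using assms by (simp add: fps_inverse_compose fps_compose_add_distrib)
  then show ?thesis
    by (simp add: fps_inverse_fps_X_plus1 fps_compose_nth)
qed

text \<open>\<open>incomplete_bell\<close> ignores \<open>b 0\<close>, so its base series is the
  given one minus \<open>1\<close>; \<open>fact k\<close> cancels its
  \<open>1 / fact k\<close>.\<close>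

lemma inverse_egf_nth:
  assumes "b 0 = 1"
  shows "fact n * fps_nth (inverse (Abs_fps (\<lambda>i. b i / fact i))) n =
    (\<Sum>k = 0..n. (-1) ^ k * fact k * incomplete_bell n k b)"
proof -
  let ?F = "Abs_fps (\<lambda>i. if i = 0 then 0 else b i / fact i)"
  have "Abs_fps (\<lambda>i. b i / fact i) = 1 + ?F"
    using assms by (auto simp: fps_eq_iff)
  then show ?thesis
    by (simp add: fps_inverse_one_plus_nth incomplete_bell_def sum_distrib_left mult_ac)
qed

lemma incomplete_bell_0_right: "incomplete_bell n 0 b = (if n = 0 then 1 else 0)"
  by (simp add: incomplete_bell_def)

text \<open>The factor \<open>fps_X\<close> on the left replaces a division by
  \<open>t\<close>.\<close>

lemma mersenne_gf:
  assumes "lam \<noteq> 0"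
  shows "fps_X * (degen_exp lam (x + 1) *
      inverse (Abs_fps (\<lambda>n. degen_bernoulli lam n x / fact n))) =
    degen_exp lam 2 - degen_exp lam 1"
proof -
  define B where "B = Abs_fps (\<lambda>n. degen_bernoulli lam n x / fact n)"
  have B0: "fps_nth B 0 = 1"
    by (simp add: B_def degen_bernoulli_0)
  have "degen_exp lam 2 - degen_exp lam 1 = degen_exp lam 1 * (degen_exp lam 1 - 1)"
    using degen_exp_add[OF assms, of 1 1] by (simp add: algebra_simps)
  also have "\<dots> = degen_exp lam 1 * (B * (degen_exp lam 1 - 1)) * inverse B"
  proof -
    have "B * inverse B = 1"
      using B0 by (intro inverse_mult_eq_1') simp
    then show ?thesis
      by (metis mult.assoc mult.commute mult.right_neutral)
  qed
  also have "\<dots> = fps_X * (degen_exp lam (x + 1) * inverse B)"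
    unfolding B_def degen_bernoulli_gf degen_exp_add[OF assms] by (simp only: mult_ac)
  finally show ?thesis
    by (simp add: B_def)
qed

theorem theorem2:
  fixes lam x :: real and n :: nat
  assumes "lam \<noteq> 0" and "n \<ge> 1"
  shows "dimorphic_mersenne lam (n + 1) / real (n + 1) =
    degen_ffact lam (x + 1) n +
    (\<Sum>j = 1..n. \<Sum>k = 1..j.
       real (n choose j) * degen_ffact lam (x + 1) (n - j) * (-1) ^ k * fact k *
       incomplete_bell j k (\<lambda>i. degen_bernoulli lam i x))"
proof -
  let ?b = "\<lambda>i. degen_bernoulli lam i x"
  define B where "B = Abs_fps (\<lambda>n. ?b n / fact n)"
  define c where "c j = fact j * fps_nth (inverse B) j" for j
  have c: "c j = (\<Sum>k = 0..j. (-1) ^ k * fact k * incomplete_bell j k ?b)" for j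
    unfolding c_def B_def by (rule inverse_egf_nth) (rule degen_bernoulli_0)
  have c0: "c 0 = 1"
    by (simp add: c incomplete_bell_0_right)
  \<comment> \<open>The term \<open>k = 0\<close> contributes only at \<open>j = 0\<close>, where it
    yields the isolated summand of the claim.\<close>
  have c_pos: "c j = (\<Sum>k = 1..j. (-1) ^ k * fact k * incomplete_bell j k ?b)" if "j \<ge> 1" for j
    using that by (simp add: c sum.atLeast_Suc_atMost incomplete_bell_0_right)
  have "dimorphic_mersenne lam (n + 1) / fact (n + 1) =
      fps_nth (fps_X * (degen_exp lam (x + 1) * inverse B)) (n + 1)"
    unfolding B_def mersenne_gf[OF assms(1)]
    by (simp add: dimorphic_mersenne_def diff_divide_distrib)
  then have "dimorphic_mersenne lam (n + 1) / fact (n + 1) =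
      fps_nth (inverse B * degen_exp lam (x + 1)) n"
    by (simp add: mult.commute)
  moreover have "dimorphic_mersenne lam (n + 1) / real (n + 1) =
      fact n * (dimorphic_mersenne lam (n + 1) / fact (n + 1))"
    by (simp add: divide_simps)
  ultimately have "dimorphic_mersenne lam (n + 1) / real (n + 1) =
      fact n * fps_nth (inverse B * degen_exp lam (x + 1)) n"
    by (simp only:)
  \<comment> \<open>A product of exponential generating functions is a binomial convolution.\<close>
  also have "\<dots> = (\<Sum>j = 0..n. real (n choose j) * degen_ffact lam (x + 1) (n - j) * c j)"
    by (auto simp: fps_mult_nth sum_distrib_left binomial_fact c_def intro!: sum.cong)
  also have "\<dots> = degen_ffact lam (x + 1) n +
      (\<Sum>j = 1..n. real (n choose j) * degen_ffact lam (x + 1) (n - j) * c j)"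
    by (simp add: sum.atLeast_Suc_atMost c0)
  also have "(\<Sum>j = 1..n. real (n choose j) * degen_ffact lam (x + 1) (n - j) * c j) =
      (\<Sum>j = 1..n. \<Sum>k = 1..j. real (n choose j) * degen_ffact lam (x + 1) (n - j) *
         (-1) ^ k * fact k * incomplete_bell j k ?b)"
    by (intro sum.cong refl) (simp add: c_pos sum_distrib_left mult.assoc)
  finally show ?thesis .
qed

end
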